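(* Let $G$ be a complete multipartite graph having exactly $n\ge 1$ parts of odd cardinality, and suppose $n=j^{2}+\delta$ for a positive integer $j$ and some $\delta\in\{-2,0,2\}$. Then the cordial vertex deficiency satisfies $\mathrm{cvd}(G)\le j-1$.
   Context: Graphs are finite and may have multiple edges but no loops. A binary labeling of a graph $G$ is a map $f:V(G)\to\{0,1\}$, inducing an edge labeling $f_e(uv)=f(u)+f(v)\pmod 2$. Two real numbers $x,y$ are roughly equal if $|x-y|\le 1$. A binary labeling $f$ is friendly if $|f^{-1}(0)|$ and $|f^{-1}(1)|$ are roughly equal, and cordial if it is friendly and $|f_e^{-1}(0)|$ and $|f_e^{-1}(1)|$ are roughly equal. The cordial vertex deficiency $\mathrm{cvd}(G)$ is the minimum, taken over all binary labelings $f$ of $G$ for which $|f_e^{-1}(0)|$ and $|f_e^{-1}(1)|$ are roughly equal, of the number of labeled isolated vertices that must be added to $G$ so that (the extension of) $f$ becomes a friendly (hence cordial) labeling of the augmented graph; if no such binary labeling exists, $\mathrm{cvd}(G)=\infty$. A complete multipartite graph is a graph whose vertex set is partitioned into nonempty parts, with two vertices adjacent (by a single edge) if and only if they lie in different parts. *)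

theory Defs
  imports Complex_Main "HOL-Library.Multiset" "HOL-Library.Extended_Nat"
    "HOL-Library.Disjoint_Sets" "HOL-Library.FuncSet"
begin

(* An edge is the set of its two end vertices; its multiplicity in the multiset is the
   number of parallel edges. *)
record 'a multigraph =
  verts :: "'a set"
  edges :: "'a set multiset"

definition is_multigraph :: "'a multigraph \<Rightarrow> bool" where
  "is_multigraph G \<longleftrightarrow>
     finite (verts G) \<and> (\<forall>e \<in># edges G. e \<subseteq> verts G \<and> card e = 2)"

definition roughly_equal :: "real \<Rightarrow> real \<Rightarrow> bool" where
  "roughly_equal x y \<longleftrightarrow> \<bar>x - y\<bar> \<le> 1"

definition binary_labeling :: "'a multigraph \<Rightarrow> ('a \<Rightarrow> nat) \<Rightarrow> bool" where
  "binary_labeling G f \<longleftrightarrow> f \<in> verts G \<rightarrow> {0, 1}"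

(* For an edge e = {u, v} with distinct ends this is (f u + f v) mod 2. *)
definition edge_label :: "('a \<Rightarrow> nat) \<Rightarrow> 'a set \<Rightarrow> nat" where
  "edge_label f e = (\<Sum>v\<in>e. f v) mod 2"

definition friendly :: "'a multigraph \<Rightarrow> ('a \<Rightarrow> nat) \<Rightarrow> bool" where
  "friendly G f \<longleftrightarrow>
     roughly_equal (card {v \<in> verts G. f v = 0}) (card {v \<in> verts G. f v = 1})"

definition edge_balanced :: "'a multigraph \<Rightarrow> ('a \<Rightarrow> nat) \<Rightarrow> bool" where
  "edge_balanced G f \<longleftrightarrow>
     roughly_equal (size {#e \<in># edges G. edge_label f e = 0#})
                   (size {#e \<in># edges G. edge_label f e = 1#})"

(* The summand nat supplies the k new vertices. *)
definition add_isolated :: "nat \<Rightarrow> 'a multigraph \<Rightarrow> ('a + nat) multigraph" where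
  "add_isolated k G =
     \<lparr>verts = Inl ` verts G \<union> Inr ` {..<k}, edges = image_mset ((`) Inl) (edges G)\<rparr>"

definition friendly_deficiency :: "'a multigraph \<Rightarrow> ('a \<Rightarrow> nat) \<Rightarrow> enat" where
  "friendly_deficiency G f =
     Inf {enat k | k. \<exists>g. binary_labeling (add_isolated k G) g \<and>
                           (\<forall>v \<in> verts G. g (Inl v) = f v) \<and>
                           friendly (add_isolated k G) g}"

(* In enat the infimum of a nonempty set is its minimum, and that of the empty set is infinity. *)
definition cvd :: "'a multigraph \<Rightarrow> enat" where
  "cvd G = (INF f \<in> {f. binary_labeling G f \<and> edge_balanced G f}. friendly_deficiency G f)"

(* partition_on requires the parts to be nonempty; mset_set gives every edge multiplicity one. *)
definition complete_multipartite :: "'a multigraph \<Rightarrow> 'a set set \<Rightarrow> bool" where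
  "complete_multipartite G P \<longleftrightarrow>
     is_multigraph G \<and> partition_on (verts G) P \<and>
     edges G = mset_set {{u, v} | u v. \<exists>A\<in>P. \<exists>B\<in>P. A \<noteq> B \<and> u \<in> A \<and> v \<in> B}"

end

theory Submission
  imports Defs
begin

text \<open>Write \<open>s A\<close> for the number of zeros minus the number of ones in a part \<open>A\<close>, and \<open>S\<close> for the
sum of all \<open>s A\<close>. Replacing the labels 0 and 1 by the signs 1 and -1, the number of edges
labeled 0 minus the number labeled 1 is the second elementary symmetric polynomial of the
\<open>s A\<close>, that is, \<open>(S\<^sup>2 - (\<Sum>A. (s A)\<^sup>2)) / 2\<close>. Choose \<open>s A = 0\<close> on the even parts and
\<open>s A = 1\<close> or \<open>s A = -1\<close> on the odd ones with \<open>S = j\<close>, which is possible as \<open>j \<le> n\<close> have the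
same parity. The edge difference is then \<open>(j\<^sup>2 - n) / 2 = - \<delta> / 2\<close>, and \<open>j - 1\<close> new vertices
labeled 1 reduce the vertex difference from \<open>j\<close> to 1.\<close>

definition label_sign :: "('a \<Rightarrow> nat) \<Rightarrow> 'a \<Rightarrow> int" where
  "label_sign f v = (if f v = 0 then 1 else - 1)"

lemma sum_pm1_eq_card_diff:
  assumes "finite E"
  shows "(\<Sum>e\<in>E. if Q e then 1 else (- 1 :: int)) = int (card {e \<in> E. Q e}) - int (card {e \<in> E. \<not> Q e})"
proof -
  have "(\<Sum>e\<in>E. if Q e then 1 else (- 1 :: int))
      = (\<Sum>e\<in>E \<inter> {e. Q e}. 1) + (\<Sum>e\<in>E \<inter> - {e. Q e}. - 1)"
    using assms by (rule sum.If_cases)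
  moreover have "E \<inter> {e. Q e} = {e \<in> E. Q e}" "E \<inter> - {e. Q e} = {e \<in> E. \<not> Q e}" by auto
  ultimately show ?thesis by (simp add: sum_negf)
qed

lemma edge_balanced_iff_sum:
  assumes "edges G = mset_set E" and "finite E"
  shows "edge_balanced G f \<longleftrightarrow>
    \<bar>\<Sum>e\<in>E. if edge_label f e = 0 then 1 else (- 1 :: int)\<bar> \<le> 1"
proof -
  have "{e \<in> E. edge_label f e = 1} = {e \<in> E. \<not> edge_label f e = 0}"
    by (auto simp: edge_label_def)
  then show ?thesis
    using assms sum_pm1_eq_card_diff[OF assms(2), of "\<lambda>e. edge_label f e = 0"]
    by (simp add: edge_balanced_def roughly_equal_def filter_mset_mset_set) linarith
qed

text \<open>Signs turn addition mod 2 into multiplication. The ends must differ, since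
  \<open>edge_label\<close> sums over the set \<open>{u, v}\<close>, which has two terms only
  then.\<close>

lemma edge_sign_doubleton:
  assumes "u \<noteq> v" "f u \<in> {0, 1}" "f v \<in> {0, 1}"
  shows "(if edge_label f {u, v} = 0 then 1 else - 1) = label_sign f u * label_sign f v"
  using assms by (auto simp: edge_label_def label_sign_def)

text \<open>An edge \<open>{u, v}\<close> comes from exactly two ordered pairs,
  \<open>(u, v)\<close> and \<open>(v, u)\<close>: both lie in \<open>D\<close> by symmetry, and
  they differ by irreflexivity. Passing to ordered pairs makes sums of products factor.\<close>

lemma sum_doubletons:
  fixes g :: "'a set \<Rightarrow> int"
  assumes "finite D" and "sym D" and "irrefl D"
  shows "2 * (\<Sum>e\<in>(\<lambda>(u, v). {u, v}) ` D. g e) = (\<Sum>(u, v)\<in>D. g {u, v})"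
proof -
  let ?h = "\<lambda>(u, v). {u, v}"
  have "(\<Sum>(u, v)\<in>D. g {u, v}) = (\<Sum>e\<in>?h ` D. \<Sum>p\<in>{p \<in> D. ?h p = e}. g (?h p))"
    using sum.image_gen[OF assms(1), of "\<lambda>p. g (?h p)" ?h] by (simp add: case_prod_unfold)
  also have "\<dots> = (\<Sum>e\<in>?h ` D. 2 * g e)"
  proof (rule sum.cong[OF refl])
    fix e assume "e \<in> ?h ` D"
    then obtain u v where e: "e = {u, v}" and uv: "(u, v) \<in> D" by auto
    have "u \<noteq> v" using uv assms(3) by (auto simp: irrefl_def)
    moreover have "{p \<in> D. ?h p = e} = {(u, v), (v, u)}"
      using uv assms(2) by (auto simp: e doubleton_eq_iff sym_def)
    ultimately show "(\<Sum>p\<in>{p \<in> D. ?h p = e}. g (?h p)) = 2 * g e"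
      by (simp add: e insert_commute)
  qed
  finally show ?thesis by (simp add: sum_distrib_left)
qed

text \<open>The pairs across different parts are what remains of \<open>V \<times> V\<close> after
  removing the disjoint blocks \<open>A \<times> A\<close>, and over a square
  \<open>X \<times> X\<close> the products \<open>s u * s v\<close> add up to the square of
  \<open>sum s X\<close>.\<close>

lemma sum_pairs_different_parts:
  fixes s :: "'a \<Rightarrow> int"
  assumes "finite V" and P: "partition_on V P"
  shows "(\<Sum>(u, v)\<in>{(u, v). \<exists>A\<in>P. \<exists>B\<in>P. A \<noteq> B \<and> u \<in> A \<and> v \<in> B}. s u * s v)
     = (\<Sum>A\<in>P. sum s A)\<^sup>2 - (\<Sum>A\<in>P. (sum s A)\<^sup>2)" (is "sum _ ?D = _")
proof -
  have finP: "finite P" and finA: "\<And>A. A \<in> P \<Longrightarrow> finite A"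
    using finite_elements[OF assms] assms by (auto simp: partition_on_def intro: finite_subset)
  have disj: "\<And>A B. A \<in> P \<Longrightarrow> B \<in> P \<Longrightarrow> A \<noteq> B \<Longrightarrow> A \<inter> B = {}"
    using P by (auto simp: partition_on_def disjoint_def)
  have V: "V = \<Union>P" using P by (simp add: partition_on_def)
  let ?U = "\<Union>A\<in>P. A \<times> A" and ?g = "\<lambda>(u, v). s u * s v"
  have prod: "sum ?g (X \<times> X) = (sum s X)\<^sup>2" for X
    by (simp add: sum_product power2_eq_square sum.cartesian_product)
  have uniq: "\<And>A B x. A \<in> P \<Longrightarrow> B \<in> P \<Longrightarrow> x \<in> A \<Longrightarrow> x \<in> B \<Longrightarrow> A = B"
    using disj by blast
  have pair: "(u, v) \<in> ?D \<longleftrightarrow> (u, v) \<in> V \<times> V - ?U" for u v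
    unfolding V by simp (metis uniq)
  have "?D = V \<times> V - ?U" by (rule set_eqI, unfold split_paired_all) (rule pair)
  then have "sum ?g ?D = sum ?g (V \<times> V) - sum ?g ?U"
    using assms(1) by (simp only:) (rule sum_diff, auto simp: V)
  moreover have "sum ?g ?U = (\<Sum>A\<in>P. sum ?g (A \<times> A))"
    using finP finA disj by (intro sum.UNION_disjoint) auto
  moreover have "sum s V = (\<Sum>A\<in>P. sum s A)"
    unfolding V using finA disj by (subst sum.Union_disjoint) auto
  ultimately show ?thesis using assms(1) finA by (simp add: prod)
qed

text \<open>The difference of squares runs over ordered pairs and so counts every edge twice; this
  is why the bound is 2 where edge balance asks for 1.\<close>

lemma complete_multipartite_edge_balanced_iff:
  assumes G: "complete_multipartite G P" and f: "binary_labeling G f"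
  shows "edge_balanced G f \<longleftrightarrow>
    \<bar>(\<Sum>A\<in>P. sum (label_sign f) A)\<^sup>2 - (\<Sum>A\<in>P. (sum (label_sign f) A)\<^sup>2)\<bar> \<le> 2"
proof -
  let ?D = "{(u, v). \<exists>A\<in>P. \<exists>B\<in>P. A \<noteq> B \<and> u \<in> A \<and> v \<in> B}"
  let ?E = "(\<lambda>(u, v). {u, v}) ` ?D" and ?g = "\<lambda>e. if edge_label f e = 0 then 1 else (- 1 :: int)"
  have fin: "finite (verts G)" and part: "partition_on (verts G) P"
    using G by (auto simp: complete_multipartite_def is_multigraph_def)
  have V: "verts G = \<Union>P" and disj: "disjoint P" using part by (auto simp: partition_on_def)
  have "(\<lambda>(u, v). {u, v}) ` {(u, v). R u v} = {{u, v} | u v. R u v}" for R :: "'a \<Rightarrow> 'a \<Rightarrow> bool"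
    by auto
  then have "?E = {{u, v} | u v. \<exists>A\<in>P. \<exists>B\<in>P. A \<noteq> B \<and> u \<in> A \<and> v \<in> B}" .
  then have E: "edges G = mset_set ?E" using G by (simp add: complete_multipartite_def)
  have "?D \<subseteq> verts G \<times> verts G" by (auto simp: V)
  then have finD: "finite ?D" using fin by (meson finite_SigmaI finite_subset)
  have irr: "irrefl ?D" using disj by (auto simp: irrefl_def disjoint_def)
  have "2 * sum ?g ?E = (\<Sum>(u, v)\<in>?D. ?g {u, v})"
    using finD irr by (intro sum_doubletons) (auto simp: sym_def)
  also have "\<dots> = (\<Sum>(u, v)\<in>?D. label_sign f u * label_sign f v)"
  proof (intro sum.cong refl)
    fix p assume p: "p \<in> ?D"
    obtain u v where [simp]: "p = (u, v)" by (cases p)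
    have "u \<noteq> v" using p irr by (auto simp: irrefl_def)
    moreover have "u \<in> verts G" "v \<in> verts G" using p by (auto simp: V)
    then have "f u \<in> {0, 1}" "f v \<in> {0, 1}"
      using f unfolding binary_labeling_def by (blast dest: funcset_mem)+
    ultimately show "(case p of (u, v) \<Rightarrow> ?g {u, v})
        = (case p of (u, v) \<Rightarrow> label_sign f u * label_sign f v)"
      by (simp only: \<open>p = (u, v)\<close> prod.case edge_sign_doubleton simp_thms)
  qed
  also have "\<dots> = (\<Sum>A\<in>P. sum (label_sign f) A)\<^sup>2 - (\<Sum>A\<in>P. (sum (label_sign f) A)\<^sup>2)"
    by (rule sum_pairs_different_parts[OF fin part])
  finally show ?thesis
    using edge_balanced_iff_sum[OF E finite_imageI[OF finD], of f] by linarith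
qed

text \<open>With \<open>B A\<close> the set of ones in \<open>A\<close>, the sign sum of
  \<open>A\<close> is \<open>card A - 2 * card (B A)\<close>, which takes every value between
  \<open>- card A\<close> and \<open>card A\<close> of the right parity. Disjoint parts can be
  labeled independently.\<close>

lemma labeling_with_part_sums:
  fixes t :: "'a set \<Rightarrow> int"
  assumes "finite V" and P: "partition_on V P"
    and t: "\<And>A. A \<in> P \<Longrightarrow> \<bar>t A\<bar> \<le> int (card A) \<and> even (int (card A) - t A)"
  obtains f where "f \<in> V \<rightarrow> {0, 1}" and "\<And>A. A \<in> P \<Longrightarrow> sum (label_sign f) A = t A"
proof -
  have finA: "\<And>A. A \<in> P \<Longrightarrow> finite A"
    using assms(1) P by (auto simp: partition_on_def intro: finite_subset)
  have "\<exists>B \<subseteq> A. int (card A) - 2 * int (card B) = t A" if A: "A \<in> P" for A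
  proof -
    \<comment> \<open>\<open>?m\<close> is the number of ones needed in \<open>A\<close>. The
      division is exact by parity, \<open>t A \<le> card A\<close> makes \<open>nat\<close>
      harmless, and \<open>- t A \<le> card A\<close> gives \<open>?m \<le> card A\<close>.\<close>
    let ?m = "nat ((int (card A) - t A) div 2)"
    have m: "int (card A) - 2 * int ?m = t A" and "?m \<le> card A"
      using t[OF A] by (auto elim!: evenE)
    then obtain B where "B \<subseteq> A" "card B = ?m" by (meson obtain_subset_with_card_n)
    with m show ?thesis by auto
  qed
  then obtain B where B: "\<And>A. A \<in> P \<Longrightarrow> B A \<subseteq> A"
    and cB: "\<And>A. A \<in> P \<Longrightarrow> int (card A) - 2 * int (card (B A)) = t A"
    by metis
  define f where "f v = (if v \<in> (\<Union>A\<in>P. B A) then 1 else 0 :: nat)" for v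
  have "sum (label_sign f) A = t A" if A: "A \<in> P" for A
  proof -
    have "A \<inter> A' = {}" if "A' \<in> P" "A \<noteq> A'" for A'
      using P A that by (auto simp: partition_on_def disjoint_def)
    \<comment> \<open>The ones chosen in other parts do not meet \<open>A\<close>.\<close>
    then have iff: "v \<in> (\<Union>A\<in>P. B A) \<longleftrightarrow> v \<in> B A" if "v \<in> A" for v
      using that A B by blast
    have "sum (label_sign f) A = (\<Sum>v\<in>A. if v \<notin> B A then 1 else - 1)"
      by (rule sum.cong) (simp_all only: label_sign_def f_def iff, simp)
    also have "\<dots> = int (card (A - B A)) - int (card (B A))"
    proof -
      have "{v \<in> A. v \<notin> B A} = A - B A" "{v \<in> A. \<not> v \<notin> B A} = B A" using B[OF A] by auto
      then show ?thesis by (simp only: sum_pm1_eq_card_diff[OF finA[OF A]])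
    qed
    also have "\<dots> = t A"
      using cB[OF A] B[OF A] finA[OF A] card_mono[of A "B A"]
      by (simp add: card_Diff_subset finite_subset of_nat_diff)
    finally show ?thesis .
  qed
  moreover have "f \<in> V \<rightarrow> {0, 1}" by (simp add: f_def)
  ultimately show ?thesis by (rule that[rotated])
qed

lemma friendly_deficiency_le:
  assumes fin: "finite (verts G)" and f: "binary_labeling G f"
    and sum: "sum (label_sign f) (verts G) = int j" and "j \<ge> 1"
  shows "friendly_deficiency G f \<le> enat (j - 1)"
proof -
  let ?H = "add_isolated (j - 1) G" and ?g = "case_sum f (\<lambda>_::nat. 1)"
  have "{v \<in> verts G. f v = 1} = {v \<in> verts G. \<not> f v = 0}"
    using f by (auto simp: binary_labeling_def Pi_iff)
  then have diff: "int (card {v \<in> verts G. f v = 0}) - int (card {v \<in> verts G. f v = 1}) = int j"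
    using sum sum_pm1_eq_card_diff[OF fin, of "\<lambda>v. f v = 0"] by (simp add: label_sign_def[abs_def])
  have "{v \<in> verts ?H. ?g v = 0} = Inl ` {v \<in> verts G. f v = 0}"
    by (auto simp: add_isolated_def)
  then have zeros: "card {v \<in> verts ?H. ?g v = 0} = card {v \<in> verts G. f v = 0}"
    by (simp add: card_image)
  have "{v \<in> verts ?H. ?g v = 1} = {v \<in> verts G. f v = 1} <+> {..<j - 1}"
    by (auto simp: add_isolated_def Plus_def)
  then have "card {v \<in> verts ?H. ?g v = 1} = card {v \<in> verts G. f v = 1} + (j - 1)"
    using fin by (simp add: card_Plus)
  \<comment> \<open>Since \<open>j \<ge> 1\<close>, the subtraction \<open>j - 1\<close> is not
    truncated, and the surplus of zeros becomes exactly \<open>j - (j - 1) = 1\<close>.\<close>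
  with zeros diff \<open>j \<ge> 1\<close> have "friendly ?H ?g"
    unfolding friendly_def roughly_equal_def by linarith
  moreover have "binary_labeling ?H ?g"
    using f by (auto simp: binary_labeling_def add_isolated_def Pi_iff)
  ultimately show ?thesis
    unfolding friendly_deficiency_def by (intro Inf_lower) force
qed

text \<open>These are the conditions for \<open>j\<close> to be a sum of \<open>n\<close> signs. For
  \<open>j \<ge> 2\<close>, \<open>n \<ge> j * j - 2 \<ge> 2 * j - 2 \<ge> j\<close>; for
  \<open>j = 1\<close> the bound is \<open>n \<ge> 1\<close>. The parities agree because
  \<open>j * j\<close> has the parity of \<open>j\<close> and \<open>\<delta>\<close> is
  even.\<close>

lemma le_and_same_parity_of_near_square:
  fixes n j :: nat and \<delta> :: int
  assumes "n \<ge> 1" "j \<ge> 1" "\<delta> \<in> {-2, 0, 2}" "int n = (int j)\<^sup>2 + \<delta>"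
  shows "j \<le> n" and "even (n + j)"
proof -
  show "j \<le> n"
  proof (cases "j = 1")
    case False
    with assms have "2 * int j \<le> (int j)\<^sup>2" by (simp add: power2_eq_square)
    moreover have "\<delta> \<ge> -2" using assms(3) by auto
    ultimately show ?thesis using False assms by linarith
  qed (use assms in simp)
  have "even (int n + int j)" using assms(3,4) by auto
  then show "even (n + j)" by presburger
qed

theorem theorem5:
  fixes G :: "'a multigraph" and P :: "'a set set" and n j :: nat and \<delta> :: int
  assumes "complete_multipartite G P"
    and "card {A \<in> P. odd (card A)} = n"
    and "n \<ge> 1"
    and "j \<ge> 1"
    and "\<delta> \<in> {-2, 0, 2}"
    and "int n = (int j)\<^sup>2 + \<delta>"
  shows "cvd G \<le> enat (j - 1)"
proof -
  let ?O = "{A \<in> P. odd (card A)}"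
  have fin: "finite (verts G)" and part: "partition_on (verts G) P"
    using assms(1) by (auto simp: complete_multipartite_def is_multigraph_def)
  have finP: "finite P" using finite_elements[OF fin part] .
  have V: "verts G = \<Union>P" and disj: "disjoint P" using part by (auto simp: partition_on_def)
  have "j \<le> n" "even (n + j)" using le_and_same_parity_of_near_square assms(3-6) by blast+
  \<comment> \<open>\<open>k\<close> odd parts get sum 1 and the other \<open>n - k\<close> get sum
    -1, so \<open>k - (n - k) = j\<close> is required.\<close>
  then obtain k where k: "n + j = 2 * k" by (blast elim: evenE)
  with \<open>j \<le> n\<close> have "k \<le> n" by simp
  then obtain T where T: "T \<subseteq> ?O" "card T = k"
    using assms(2) by (metis (no_types, lifting) obtain_subset_with_card_n)
  define t where "t A = (if odd (card A) then if A \<in> T then 1 else - 1 else 0 :: int)" for A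
  have "\<bar>t A\<bar> \<le> int (card A) \<and> even (int (card A) - t A)" if "A \<in> P" for A
    by (auto simp: t_def Suc_le_eq odd_pos)
  then obtain f where "f \<in> verts G \<rightarrow> {0, 1}"
    and sf: "\<And>A. A \<in> P \<Longrightarrow> sum (label_sign f) A = t A"
    using labeling_with_part_sums[OF fin part, of t] by metis
  then have f: "binary_labeling G f" by (simp add: binary_labeling_def)
  have "(\<Sum>A\<in>P. t A) = (\<Sum>A\<in>?O. if A \<in> T then 1 else - 1)"
    using finP by (simp add: t_def sum.inter_filter)
  also have "\<dots> = int (card T) - int (card (?O - T))"
  proof -
    have "{A \<in> ?O. A \<in> T} = T" "{A \<in> ?O. A \<notin> T} = ?O - T" using T by auto
    then show ?thesis using finP by (subst sum_pm1_eq_card_diff) simp_all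
  qed
  also have "\<dots> = int j"
    using T k \<open>k \<le> n\<close> finP assms(2) by (subst card_Diff_subset) (auto intro: finite_subset)
  finally have S: "(\<Sum>A\<in>P. sum (label_sign f) A) = int j" using sf by simp
  \<comment> \<open>Squaring forgets the choice of \<open>T\<close>: every odd part contributes
    1.\<close>
  have "(\<Sum>A\<in>P. (t A)\<^sup>2) = (\<Sum>A\<in>P. if odd (card A) then 1 else 0)"
    by (rule sum.cong) (auto simp: t_def)
  also have "\<dots> = int n" using finP assms(2) by (simp flip: sum.inter_filter)
  finally have "(\<Sum>A\<in>P. (sum (label_sign f) A)\<^sup>2) = int n" using sf by simp
  \<comment> \<open>The difference of squares is \<open>j * j - n = - \<delta>\<close>, of absolute
    value at most 2.\<close>
  with S assms(5,6) have "edge_balanced G f"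
    by (subst complete_multipartite_edge_balanced_iff[OF assms(1) f]) auto
  moreover have "sum (label_sign f) (verts G) = int j"
    using S fin disj unfolding V
    by (subst sum.Union_disjoint) (auto simp: disjoint_def intro: finite_subset)
  then have "friendly_deficiency G f \<le> enat (j - 1)"
    using friendly_deficiency_le[OF fin f] assms(4) by blast
  ultimately show ?thesis
    unfolding cvd_def using f by (intro INF_lower2[of f]) auto
qed

end
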